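(* Let $t$ and $m$ be non-zero complex numbers. The tensor product representation $\hat{\phi}_B(t)\otimes\hat{\phi}_B(m)$ of $C_3$ on $\mathbb{C}^2\otimes\mathbb{C}^2$ is irreducible if and only if $t\neq m$.
   Context: Let $\mathbb{F}_3$ be the free group on $x_1,x_2,x_3$. The group $C_3$ of conjugating automorphisms is the subgroup of $\mathrm{Aut}(\mathbb{F}_3)$ of all automorphisms $\phi$ such that $\phi(x_i)=f_i^{-1}x_{\Pi(i)}f_i$ for all $i$, for some permutation $\Pi$ of $\{1,2,3\}$ and some $f_i\in\mathbb{F}_3$. It is generated by the automorphisms $\epsilon_{ij}$, $1\le i\ne j\le 3$, where $\epsilon_{ij}(x_i)=x_j^{-1}x_ix_j$ and $\epsilon_{ij}(x_l)=x_l$ for $l\ne i$, together with $\alpha_1,\alpha_2$, where $\alpha_i$ swaps $x_i$ and $x_{i+1}$ and fixes the remaining generator. Products of automorphisms are taken in the right-action convention: $\phi\psi$ means first apply $\phi$, then $\psi$. For a non-zero complex number $t$, $\hat{\phi}_B(t):C_3\to GL_2(\mathbb{C})$ is the homomorphism given on generators (matrices acting on column vectors from the left) by $$\epsilon_{12}\mapsto\begin{pmatrix}t^{-1}&1-t^{-1}\\0&1\end{pmatrix},\quad \epsilon_{21}\mapsto\begin{pmatrix}1&0\\1-t^{-1}&t^{-1}\end{pmatrix},\quad \epsilon_{13}\mapsto\begin{pmatrix}t^{-1}&0\\0&1\end{pmatrix},$$ $$\epsilon_{31}\mapsto\begin{pmatrix}t^{-1}&0\\t^{-1}-1&1\end{pmatrix},\quad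 \epsilon_{32}\mapsto\begin{pmatrix}1&t^{-1}-1\\0&t^{-1}\end{pmatrix},\quad \epsilon_{23}\mapsto\begin{pmatrix}1&0\\0&t^{-1}\end{pmatrix},$$ $$\alpha_1\mapsto\begin{pmatrix}0&1\\1&0\end{pmatrix},\quad \alpha_2\mapsto\begin{pmatrix}1&-1\\0&-1\end{pmatrix}.$$ (These assignments do define a homomorphism. It arises as the action on $\mathbb{C}^3/\langle(1,1,1)^T\rangle$ induced by the representation sending $\alpha_i$ to the permutation matrix of $(i\ \ i+1)$ and $\epsilon_{ij}$ to the $3\times3$ matrix that agrees with the identity except in row $i$, which has $(i,i)$ entry $t^{-1}$, $(i,j)$ entry $1-t^{-1}$ and zero otherwise.) The tensor product representation sends $g$ to $\hat{\phi}_B(t)(g)\otimes\hat{\phi}_B(m)(g)$. Irreducible means that the only subspaces of the representation space invariant under the whole group are $0$ and the whole space. *)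

theory Defs
  imports
    "HOL-Algebra.Bij"
    "HOL-Analysis.Analysis"
begin

section \<open>Free groups as reduced words\<close>

text \<open>The letter \<open>(i, True)\<close> stands for \<open>x\<^sub>i\<close> and \<open>(i, False)\<close> for its inverse.\<close>

type_synonym 'a word = "('a \<times> bool) list"

definition reduced :: "'a word \<Rightarrow> bool" where
  "reduced = successively (\<lambda>a b. b \<noteq> (fst a, \<not> snd a))"

fun push :: "'a \<times> bool \<Rightarrow> 'a word \<Rightarrow> 'a word" where
  "push a [] = [a]"
| "push a (b # w) = (if b = (fst a, \<not> snd a) then w else a # b # w)"

definition free_group :: "('a word) monoid" where
  "free_group = \<lparr>carrier = {w. reduced w}, monoid.mult = (\<lambda>u v. foldr push u v), one = []\<rparr>"

definition gen :: "'a \<Rightarrow> 'a word" where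
  "gen i = [(i, True)]"

text \<open>The endomorphism of the free group with \<open>x\<^sub>i \<mapsto> f i\<close>, extensional on the carrier.\<close>

definition free_ext :: "('a \<Rightarrow> 'a word) \<Rightarrow> 'a word \<Rightarrow> 'a word" where
  "free_ext f = (\<lambda>w\<in>carrier free_group.
     foldr (\<lambda>a u. (if snd a then f (fst a) else inv\<^bsub>free_group\<^esub> f (fst a)) \<otimes>\<^bsub>free_group\<^esub> u)
       w \<one>\<^bsub>free_group\<^esub>)"

section \<open>Conjugating automorphisms\<close>

text \<open>
  The indices 1, 2, 3 are the three elements of the type \<open>3\<close> (so \<open>3 = 0\<close> there).
  The product of the library group \<open>AutoGroup\<close> is composition of maps, applying the right
  factor first; the group below is its opposite, so that \<open>\<phi> \<otimes> \<psi>\<close> applies \<open>\<phi>\<close> first.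
\<close>

abbreviation F3 :: "(3 word) monoid" where
  "F3 \<equiv> free_group"

definition C3 :: "(3 word \<Rightarrow> 3 word) monoid" where
  "C3 = \<lparr>carrier = {\<phi> \<in> auto F3. \<exists>p f. p permutes UNIV \<and> (\<forall>i. f i \<in> carrier F3 \<and>
             \<phi> (gen i) = inv\<^bsub>F3\<^esub> f i \<otimes>\<^bsub>F3\<^esub> gen (p i) \<otimes>\<^bsub>F3\<^esub> f i)},
         monoid.mult = (\<lambda>\<phi> \<psi>. \<psi> \<otimes>\<^bsub>AutoGroup F3\<^esub> \<phi>),
         one = \<one>\<^bsub>AutoGroup F3\<^esub>\<rparr>"

definition eps :: "3 \<Rightarrow> 3 \<Rightarrow> 3 word \<Rightarrow> 3 word" where
  "eps i j = free_ext (\<lambda>l. if l = i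
     then inv\<^bsub>F3\<^esub> gen j \<otimes>\<^bsub>F3\<^esub> gen i \<otimes>\<^bsub>F3\<^esub> gen j else gen l)"

definition alpha :: "3 \<Rightarrow> 3 word \<Rightarrow> 3 word" where
  "alpha i = free_ext (\<lambda>l. if l = i then gen (i + 1) else if l = i + 1 then gen i else gen l)"

section \<open>Matrix representations\<close>

definition GL :: "(complex ^ 'n ^ 'n) monoid" where
  "GL = \<lparr>carrier = {A. invertible A}, monoid.mult = (**), one = mat 1\<rparr>"

definition irreducible_rep ::
    "('g, 'b) monoid_scheme \<Rightarrow> ('g \<Rightarrow> complex ^ 'n ^ 'n) \<Rightarrow> bool" where
  "irreducible_rep G \<rho> \<longleftrightarrow>
     (\<forall>W. vec.subspace W \<and> (\<forall>g\<in>carrier G. \<forall>v\<in>W. \<rho> g *v v \<in> W) \<longrightarrow> W = {0} \<or> W = UNIV)"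

text \<open>
  \<open>\<complex>\<^sup>m \<otimes> \<complex>\<^sup>n\<close> is the coordinate space indexed by pairs, with \<open>e\<^sub>i \<otimes> e\<^sub>j\<close> the standard basis vector
  of index \<open>(i, j)\<close>; lemma \<open>kron_tensor_vec\<close> below states that \<open>kron A B\<close> is \<open>A \<otimes> B\<close>.
\<close>

definition kron ::
    "complex ^ 'm ^ 'm \<Rightarrow> complex ^ 'n ^ 'n \<Rightarrow> complex ^ ('m \<times> 'n) ^ ('m \<times> 'n)" where
  "kron A B = (\<chi> p q. A $ fst p $ fst q * B $ snd p $ snd q)"

definition tensor_vec :: "complex ^ 'm \<Rightarrow> complex ^ 'n \<Rightarrow> complex ^ ('m \<times> 'n)" where
  "tensor_vec v w = (\<chi> p. v $ fst p * w $ snd p)"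

definition tensor_rep ::
    "('g \<Rightarrow> complex ^ 'm ^ 'm) \<Rightarrow> ('g \<Rightarrow> complex ^ 'n ^ 'n) \<Rightarrow>
     'g \<Rightarrow> complex ^ ('m \<times> 'n) ^ ('m \<times> 'n)" where
  "tensor_rep \<rho> \<sigma> g = kron (\<rho> g) (\<sigma> g)"

lemma kron_tensor_vec:
  "kron A B *v tensor_vec v w = tensor_vec (A *v v) (B *v w)"
proof -
  have "(\<Sum>q\<in>UNIV. A $ fst p $ fst q * B $ snd p $ snd q * (v $ fst q * w $ snd q)) =
        (\<Sum>j\<in>UNIV. A $ fst p $ j * v $ j) * (\<Sum>k\<in>UNIV. B $ snd p $ k * w $ k)" for p
    unfolding sum_product sum.cartesian_product UNIV_Times_UNIV
    by (intro sum.cong) (auto simp: algebra_simps)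
  then show ?thesis
    by (simp add: kron_def tensor_vec_def matrix_vector_mult_def vec_eq_iff)
qed

section \<open>The representation\<close>

abbreviation mat2 :: "complex \<Rightarrow> complex \<Rightarrow> complex \<Rightarrow> complex \<Rightarrow> complex ^ 2 ^ 2" where
  "mat2 a b c d \<equiv> vector [vector [a, b], vector [c, d]]"

definition is_phi_B :: "complex \<Rightarrow> ((3 word \<Rightarrow> 3 word) \<Rightarrow> complex ^ 2 ^ 2) \<Rightarrow> bool" where
  "is_phi_B t \<rho> \<longleftrightarrow> \<rho> \<in> hom C3 GL \<and>
     \<rho> (eps 1 2) = mat2 (inverse t) (1 - inverse t) 0 1 \<and>
     \<rho> (eps 2 1) = mat2 1 0 (1 - inverse t) (inverse t) \<and>
     \<rho> (eps 1 3) = mat2 (inverse t) 0 0 1 \<and>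
     \<rho> (eps 3 1) = mat2 (inverse t) 0 (inverse t - 1) 1 \<and>
     \<rho> (eps 3 2) = mat2 1 (inverse t - 1) 0 (inverse t) \<and>
     \<rho> (eps 2 3) = mat2 1 0 0 (inverse t) \<and>
     \<rho> (alpha 1) = mat2 0 1 1 0 \<and>
     \<rho> (alpha 2) = mat2 1 (-1) 0 (-1)"

text \<open>
  For \<open>t \<noteq> 0\<close> such a homomorphism exists (lemma \<open>is_phi_B_phi_B\<close> below), and it is unique on the
  carrier of \<open>C3\<close> because the \<open>eps i j\<close> and \<open>alpha i\<close> generate \<open>C3\<close>.
\<close>

definition phi_B :: "complex \<Rightarrow> (3 word \<Rightarrow> 3 word) \<Rightarrow> complex ^ 2 ^ 2" where
  "phi_B t = (SOME \<rho>. is_phi_B t \<rho>)"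

section \<open>Free groups are groups\<close>

lemma reduced_Nil [simp]: "reduced []"
  by (simp add: reduced_def)

lemma reduced_push: "reduced w \<Longrightarrow> reduced (push a w)"
  by (cases w) (auto simp: reduced_def successively_Cons)

lemma reduced_Cons: "reduced (a # w) \<longleftrightarrow> reduced w \<and> push a w = a # w"
  by (cases w) (auto simp: reduced_def successively_Cons dest: arg_cong[where f = length])

lemma reduced_foldr_push: "reduced v \<Longrightarrow> reduced (foldr push u v)"
  by (induction u) (auto intro: reduced_push)

lemma foldr_push_Nil: "reduced u \<Longrightarrow> foldr push u [] = u"
  by (induction u) (auto simp: reduced_Cons)

lemma push_push: "reduced w \<Longrightarrow> push a (push (fst a, \<not> snd a) w) = w"
  by (cases w; cases "tl w") (auto simp: reduced_def)

lemma foldr_push_push: "reduced v \<Longrightarrow> foldr push (push a u) v = push a (foldr push u v)"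
proof (cases u)
  case (Cons b w)
  moreover assume "reduced v"
  then have "reduced (foldr push w v)"
    by (rule reduced_foldr_push)
  ultimately show ?thesis
    using push_push[of "foldr push w v" a] by auto
qed auto

lemma foldr_push_assoc:
  "reduced w \<Longrightarrow> foldr push (foldr push u v) w = foldr push u (foldr push v w)"
  by (induction u) (auto simp: foldr_push_push reduced_foldr_push)

lemma foldr_push_left_inverse:
  "reduced v \<Longrightarrow> foldr push (rev (map (\<lambda>a. (fst a, \<not> snd a)) u)) (foldr push u v) = v"
proof (induction u arbitrary: v)
  case (Cons a u)
  have "push (fst a, \<not> snd a) (push a (foldr push u v)) = foldr push u v"
    using push_push[of "foldr push u v" "(fst a, \<not> snd a)"] Cons.prems
    by (simp add: reduced_foldr_push)
  then show ?case
    using Cons by simp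
qed simp

lemma group_free_group: "group (free_group :: ('a word) monoid)"
proof (rule groupI)
  fix u :: "'a word" assume u: "u \<in> carrier free_group"
  let ?v = "foldr push (rev (map (\<lambda>a. (fst a, \<not> snd a)) u)) []"
  have "?v \<in> carrier free_group"
    by (simp add: free_group_def reduced_foldr_push)
  moreover have "?v \<otimes>\<^bsub>free_group\<^esub> u = \<one>\<^bsub>free_group\<^esub>"
    using foldr_push_left_inverse[of "[]" u] foldr_push_assoc[of u _ "[]"] u
    by (simp add: free_group_def foldr_push_assoc foldr_push_Nil)
  ultimately show "\<exists>v\<in>carrier free_group. v \<otimes>\<^bsub>free_group\<^esub> u = \<one>\<^bsub>free_group\<^esub>"
    by blast
qed (auto simp: free_group_def reduced_foldr_push foldr_push_assoc)

interpretation free_group: group "free_group :: ('a word) monoid"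
  by (rule group_free_group)

lemma gen_closed [simp, intro]: "gen i \<in> carrier free_group"
  by (simp add: free_group_def gen_def reduced_def)

lemma inv_gen: "inv\<^bsub>free_group\<^esub> gen i = [(i, False)]"
  by (rule free_group.inv_equality) (auto simp: free_group_def gen_def reduced_def)

lemma Nil_free_group: "\<one>\<^bsub>free_group\<^esub> = []"
  by (simp add: free_group_def)

lemma free_group_induct [consumes 1, case_names one gen inv]:
  assumes "w \<in> carrier free_group"
    and one: "P \<one>\<^bsub>free_group\<^esub>"
    and gen: "\<And>i w. w \<in> carrier free_group \<Longrightarrow> P w \<Longrightarrow> P (gen i \<otimes>\<^bsub>free_group\<^esub> w)"
    and inv: "\<And>i w. w \<in> carrier free_group \<Longrightarrow> P w \<Longrightarrow>
                P (inv\<^bsub>free_group\<^esub> gen i \<otimes>\<^bsub>free_group\<^esub> w)"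
  shows "P w"
  using assms(1)
proof (induction w)
  case Nil
  then show ?case using one by (simp add: Nil_free_group)
next
  case (Cons a w)
  then have w: "w \<in> carrier free_group" and aw: "push a w = a # w"
    by (auto simp: free_group_def reduced_Cons)
  obtain i b where a: "a = (i, b)" by (cases a)
  have "a # w = (if b then gen i else inv\<^bsub>free_group\<^esub> gen i) \<otimes>\<^bsub>free_group\<^esub> w"
    using aw unfolding a by (cases b) (simp_all add: inv_gen, simp_all add: free_group_def gen_def)
  then show ?case
    using gen[OF w Cons.IH[OF w], of i] inv[OF w Cons.IH[OF w], of i] by simp
qed

section \<open>Endomorphisms of free groups\<close>

lemma free_ext_hom:
  fixes f :: "'a \<Rightarrow> 'a word"
  assumes f: "\<And>i. f i \<in> carrier free_group"
  shows "free_ext f \<in> hom free_group free_group"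
proof -
  define h where
    "h a = (if snd a then f (fst a) else inv\<^bsub>free_group\<^esub> f (fst a))" for a :: "'a \<times> bool"
  define E where
    "E w = foldr (\<lambda>a u. h a \<otimes>\<^bsub>free_group\<^esub> u) w \<one>\<^bsub>free_group\<^esub>" for w
  have E: "free_ext f w = E w" if "w \<in> carrier free_group" for w
    using that by (simp add: free_ext_def E_def h_def)
  have h: "h a \<in> carrier free_group" for a
    by (simp add: h_def f)
  have closed: "E w \<in> carrier free_group" for w
    by (induction w) (auto simp: E_def h)
  have cancel: "h a \<otimes>\<^bsub>free_group\<^esub> (h (fst a, \<not> snd a) \<otimes>\<^bsub>free_group\<^esub> E w) = E w" for a w
    by (cases "snd a") (auto simp: h_def f closed free_group.m_assoc [symmetric])
  have push: "E (push a w) = h a \<otimes>\<^bsub>free_group\<^esub> E w" for a w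
  proof (cases w)
    case (Cons b v)
    then show ?thesis
      using cancel[of a v] by (auto simp: E_def)
  qed (simp add: E_def)
  have "E (foldr push u v) = E u \<otimes>\<^bsub>free_group\<^esub> E v" for u v
  proof (induction u)
    case Nil
    show ?case using closed by (simp add: E_def[of "[]"])
  next
    case (Cons a u)
    have "E (a # u) = h a \<otimes>\<^bsub>free_group\<^esub> E u" by (simp add: E_def)
    with Cons show ?case by (simp add: push h closed free_group.m_assoc)
  qed
  moreover have "u \<otimes>\<^bsub>free_group\<^esub> v = foldr push u v" for u v :: "'a word"
    by (simp add: free_group_def)
  ultimately have "E (u \<otimes>\<^bsub>free_group\<^esub> v) = E u \<otimes>\<^bsub>free_group\<^esub> E v" for u v
    by simp
  with closed show ?thesis
    by (auto simp: hom_def E)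
qed

lemma free_ext_gen:
  "f i \<in> carrier free_group \<Longrightarrow> free_ext f (gen i) = f i"
  using gen_closed[of i] by (simp add: free_ext_def gen_def)

lemma free_hom_eqI:
  assumes "group H" "\<phi> \<in> hom free_group H" "\<psi> \<in> hom free_group H"
    and eq: "\<And>i. \<phi> (gen i) = \<psi> (gen i)"
    and w: "w \<in> carrier free_group"
  shows "\<phi> w = \<psi> w"
proof -
  interpret H: group H by fact
  interpret \<phi>: group_hom free_group H \<phi>
    by unfold_locales fact
  interpret \<psi>: group_hom free_group H \<psi>
    by unfold_locales fact
  show ?thesis
    using w by (induction rule: free_group_induct) (auto simp: eq)
qed

lemma free_ext_auto:
  fixes f g :: "'a \<Rightarrow> 'a word"
  assumes f: "\<And>i. f i \<in> carrier free_group" and g: "\<And>i. g i \<in> carrier free_group"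
    and gf: "\<And>i. free_ext g (f i) = gen i" and fg: "\<And>i. free_ext f (g i) = gen i"
  shows "free_ext f \<in> auto free_group"
proof -
  note hf = free_ext_hom[of f, OF f] and hg = free_ext_hom[of g, OF g]
  have id: "(\<lambda>w. w) \<in> hom free_group free_group"
    by (simp add: hom_def)
  have "free_ext g (free_ext f w) = w" if "w \<in> carrier free_group" for w
    using free_hom_eqI[OF group_free_group hom_compose[OF hf hg] id _ that]
    by (simp add: free_ext_gen f gf)
  moreover have "free_ext f (free_ext g w) = w" if "w \<in> carrier free_group" for w
    using free_hom_eqI[OF group_free_group hom_compose[OF hg hf] id _ that]
    by (simp add: free_ext_gen g fg)
  ultimately have "bij_betw (free_ext f) (carrier free_group) (carrier free_group)"
    using hf hg by (intro bij_betwI[where g = "free_ext g"]) (auto simp: hom_def)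
  with hf show ?thesis
    by (simp add: auto_def Bij_def free_ext_def)
qed

section \<open>The group of conjugating automorphisms\<close>

lemma C3_mult_apply:
  assumes "\<phi> \<in> carrier C3" "\<psi> \<in> carrier C3" "w \<in> carrier F3"
  shows "(\<phi> \<otimes>\<^bsub>C3\<^esub> \<psi>) w = \<psi> (\<phi> w)"
  using assms by (simp add: C3_def AutoGroup_def BijGroup_def auto_def compose_def)

lemma C3_hom: "\<phi> \<in> carrier C3 \<Longrightarrow> group_hom F3 F3 \<phi>"
  by (unfold_locales) (simp add: C3_def auto_def)

lemma subgroup_C3: "subgroup (carrier C3) (AutoGroup F3)"
proof -
  interpret A: group "AutoGroup F3"
    by (rule free_group.AutoGroup)
  have C3: "\<phi> \<in> carrier C3 \<longleftrightarrow> \<phi> \<in> auto F3 \<and> (\<exists>p f. p permutes UNIV \<and> (\<forall>i. f i \<in> carrier F3 \<and>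
      \<phi> (gen i) = inv\<^bsub>F3\<^esub> f i \<otimes>\<^bsub>F3\<^esub> gen (p i) \<otimes>\<^bsub>F3\<^esub> f i))" for \<phi>
    by (simp add: C3_def)
  have app: "(\<psi> \<otimes>\<^bsub>AutoGroup F3\<^esub> \<phi>) w = \<psi> (\<phi> w)"
    if "\<phi> \<in> carrier C3" "\<psi> \<in> carrier C3" "w \<in> carrier F3" for \<phi> \<psi> w
    using that by (simp add: C3_def AutoGroup_def BijGroup_def auto_def compose_def)
  show ?thesis
  proof (rule A.subgroupI)
    show "carrier C3 \<subseteq> carrier (AutoGroup F3)"
      by (auto simp: C3_def AutoGroup_def)
    have "(\<lambda>w\<in>carrier F3. w) \<in> carrier C3"
      unfolding C3
      by (intro conjI free_group.id_in_auto exI[of _ id] exI[of _ "\<lambda>_. \<one>\<^bsub>F3\<^esub>"])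
        (auto simp: permutes_id)
    then show "carrier C3 \<noteq> {}" by blast
  next
    fix \<phi> assume "\<phi> \<in> carrier C3"
    then obtain p f where \<phi>: "\<phi> \<in> auto F3" and p: "p permutes UNIV"
      and f: "\<And>i. f i \<in> carrier F3"
      and eq: "\<And>i. \<phi> (gen i) = inv\<^bsub>F3\<^esub> f i \<otimes>\<^bsub>F3\<^esub> gen (p i) \<otimes>\<^bsub>F3\<^esub> f i"
      unfolding C3 by blast
    let ?\<theta> = "inv\<^bsub>AutoGroup F3\<^esub> \<phi>"
    have \<theta>: "?\<theta> \<in> auto F3"
      using A.inv_closed[of \<phi>] \<phi> by (simp add: AutoGroup_def)
    have "?\<theta> \<otimes>\<^bsub>AutoGroup F3\<^esub> \<phi> = \<one>\<^bsub>AutoGroup F3\<^esub>"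
      using A.l_inv[of \<phi>] \<phi> by (simp add: AutoGroup_def)
    then have \<theta>\<phi>: "?\<theta> (\<phi> w) = w" if "w \<in> carrier F3" for w
      using \<phi> \<theta> that
      by (simp add: AutoGroup_def BijGroup_def auto_def compose_def fun_eq_iff split: if_splits)
    interpret h: group_hom F3 F3 ?\<theta>
      using \<theta> by unfold_locales (simp add: auto_def)
    let ?q = "inv_into UNIV p"
    have "?\<theta> (gen i) = inv\<^bsub>F3\<^esub> (inv\<^bsub>F3\<^esub> ?\<theta> (f (?q i))) \<otimes>\<^bsub>F3\<^esub> gen (?q i)
        \<otimes>\<^bsub>F3\<^esub> inv\<^bsub>F3\<^esub> ?\<theta> (f (?q i))" for i
    proof -
      let ?j = "?q i"
      have "gen i = f ?j \<otimes>\<^bsub>F3\<^esub> \<phi> (gen ?j) \<otimes>\<^bsub>F3\<^esub> inv\<^bsub>F3\<^esub> f ?j"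
        using f[of ?j]
        by (simp add: eq permutes_inverses(1)[OF p] free_group.m_assoc free_group.inv_solve_left')
           (simp add: free_group.m_assoc [symmetric])
      also have "?\<theta> \<dots> = ?\<theta> (f ?j) \<otimes>\<^bsub>F3\<^esub> gen ?j \<otimes>\<^bsub>F3\<^esub> inv\<^bsub>F3\<^esub> ?\<theta> (f ?j)"
        using f[of ?j] \<phi> by (simp add: \<theta>\<phi> auto_def hom_def Pi_iff)
      finally show ?thesis
        using f[of ?j] by simp
    qed
    then show "?\<theta> \<in> carrier C3"
      unfolding C3
      by (intro conjI \<theta> exI[of _ ?q] exI[of _ "\<lambda>i. inv\<^bsub>F3\<^esub> ?\<theta> (f (?q i))"])
        (auto simp: permutes_inv[OF p] f)
  next
    fix \<psi> \<phi> assume "\<psi> \<in> carrier C3" "\<phi> \<in> carrier C3"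
    then obtain p f q g where \<phi>: "\<phi> \<in> auto F3" and p: "p permutes UNIV"
      and f: "\<And>i. f i \<in> carrier F3"
      and eq: "\<And>i. \<phi> (gen i) = inv\<^bsub>F3\<^esub> f i \<otimes>\<^bsub>F3\<^esub> gen (p i) \<otimes>\<^bsub>F3\<^esub> f i"
      and \<psi>: "\<psi> \<in> auto F3" and q: "q permutes UNIV"
      and g: "\<And>i. g i \<in> carrier F3"
      and eq': "\<And>i. \<psi> (gen i) = inv\<^bsub>F3\<^esub> g i \<otimes>\<^bsub>F3\<^esub> gen (q i) \<otimes>\<^bsub>F3\<^esub> g i"
      unfolding C3 by blast
    interpret h: group_hom F3 F3 \<psi>
      using \<psi> by unfold_locales (simp add: auto_def)
    have "(\<psi> \<otimes>\<^bsub>AutoGroup F3\<^esub> \<phi>) (gen i) = inv\<^bsub>F3\<^esub> (g (p i) \<otimes>\<^bsub>F3\<^esub> \<psi> (f i))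
        \<otimes>\<^bsub>F3\<^esub> gen ((q \<circ> p) i) \<otimes>\<^bsub>F3\<^esub> (g (p i) \<otimes>\<^bsub>F3\<^esub> \<psi> (f i))" for i
      using f[of i] g[of "p i"]
      by (simp add: app \<open>\<psi> \<in> carrier C3\<close> \<open>\<phi> \<in> carrier C3\<close> eq eq' free_group.m_assoc
          free_group.inv_mult_group)
    moreover have "\<psi> \<otimes>\<^bsub>AutoGroup F3\<^esub> \<phi> \<in> auto F3"
      using A.m_closed[of \<psi> \<phi>] \<phi> \<psi> by (simp add: AutoGroup_def)
    ultimately show "\<psi> \<otimes>\<^bsub>AutoGroup F3\<^esub> \<phi> \<in> carrier C3"
      unfolding C3
      by (intro conjI exI[of _ "q \<circ> p"] exI[of _ "\<lambda>i. g (p i) \<otimes>\<^bsub>F3\<^esub> \<psi> (f i)"])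
        (auto simp: permutes_compose[OF p q] f g)
  qed
qed

lemma group_C3: "group C3"
proof -
  interpret A: group "AutoGroup F3"
    by (rule free_group.AutoGroup)
  interpret S: subgroup "carrier C3" "AutoGroup F3"
    by (rule subgroup_C3)
  have [simp]: "\<phi> \<otimes>\<^bsub>C3\<^esub> \<psi> = \<psi> \<otimes>\<^bsub>AutoGroup F3\<^esub> \<phi>" "\<one>\<^bsub>C3\<^esub> = \<one>\<^bsub>AutoGroup F3\<^esub>"
    for \<phi> \<psi> by (simp_all add: C3_def)
  show ?thesis
  proof (rule groupI)
    fix \<phi> assume "\<phi> \<in> carrier C3"
    then show "\<exists>\<psi>\<in>carrier C3. \<psi> \<otimes>\<^bsub>C3\<^esub> \<phi> = \<one>\<^bsub>C3\<^esub>"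
      by (intro bexI[of _ "inv\<^bsub>AutoGroup F3\<^esub> \<phi>"]) (auto simp: A.r_inv)
  qed (auto simp: A.m_assoc)
qed

lemma C3_one_apply: "w \<in> carrier F3 \<Longrightarrow> \<one>\<^bsub>C3\<^esub> w = w"
  by (simp add: C3_def AutoGroup_def BijGroup_def)

lemma eps_gen:
  "eps i j (gen l) = (if l = i
     then inv\<^bsub>F3\<^esub> gen j \<otimes>\<^bsub>F3\<^esub> gen i \<otimes>\<^bsub>F3\<^esub> gen j else gen l)"
  unfolding eps_def by (subst free_ext_gen) auto

lemma alpha_gen:
  "alpha i (gen l) = (if l = i then gen (i + 1) else if l = i + 1 then gen i else gen l)"
  unfolding alpha_def by (subst free_ext_gen) auto

lemma eps_closed:
  assumes "i \<noteq> j"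
  shows "eps i j \<in> carrier C3"
proof -
  let ?f = "\<lambda>l. if l = i then inv\<^bsub>F3\<^esub> gen j \<otimes>\<^bsub>F3\<^esub> gen i \<otimes>\<^bsub>F3\<^esub> gen j else gen l"
  let ?g = "\<lambda>l. if l = i then gen j \<otimes>\<^bsub>F3\<^esub> gen i \<otimes>\<^bsub>F3\<^esub> inv\<^bsub>F3\<^esub> gen j else gen l"
  have f: "?f l \<in> carrier F3" and g: "?g l \<in> carrier F3" for l
    by auto
  interpret f: group_hom F3 F3 "free_ext ?f"
    by unfold_locales (intro free_ext_hom f)
  interpret g: group_hom F3 F3 "free_ext ?g"
    by unfold_locales (intro free_ext_hom g)
  have "eps i j \<in> auto F3"
    unfolding eps_def
  proof (rule free_ext_auto[where f = ?f and g = ?g, OF f g])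
    show "free_ext ?g (?f l) = gen l" for l
      using assms free_ext_gen[of ?g, OF g]
      by (auto simp: free_group.m_assoc) (auto simp: free_group.m_assoc [symmetric])
    show "free_ext ?f (?g l) = gen l" for l
      using assms free_ext_gen[of ?f, OF f]
      by (auto simp: free_group.m_assoc) (auto simp: free_group.m_assoc [symmetric])
  qed
  moreover have "\<exists>p f. p permutes UNIV \<and> (\<forall>l. f l \<in> carrier F3 \<and>
      eps i j (gen l) = inv\<^bsub>F3\<^esub> f l \<otimes>\<^bsub>F3\<^esub> gen (p l) \<otimes>\<^bsub>F3\<^esub> f l)"
    by (intro exI[of _ id] exI[of _ "\<lambda>l. if l = i then gen j else \<one>\<^bsub>F3\<^esub>"])
      (auto simp: eps_gen permutes_id)
  ultimately show ?thesis
    by (simp add: C3_def)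
qed

lemma alpha_closed: "alpha i \<in> carrier C3"
proof -
  let ?s = "\<lambda>l. if l = i then i + 1 else if l = i + 1 then i else l"
  let ?f = "\<lambda>l. if l = i then gen (i + 1) else if l = i + 1 then gen i else gen l"
  have f: "?f l \<in> carrier F3" for l
    by auto
  have "alpha i \<in> auto F3"
    unfolding alpha_def
    by (rule free_ext_auto[where f = ?f and g = ?f]) (simp_all add: free_ext_gen)
  moreover have "?s permutes UNIV"
    by (rule bij_imp_permutes, rule involuntory_imp_bij) auto
  then have "\<exists>p f. p permutes UNIV \<and> (\<forall>l. f l \<in> carrier F3 \<and>
      alpha i (gen l) = inv\<^bsub>F3\<^esub> f l \<otimes>\<^bsub>F3\<^esub> gen (p l) \<otimes>\<^bsub>F3\<^esub> f l)"
    by (intro exI[of _ ?s] exI[of _ "\<lambda>_. \<one>\<^bsub>F3\<^esub>"]) (auto simp: alpha_gen)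
  ultimately show ?thesis
    by (simp add: C3_def)
qed

section \<open>Existence of the representation\<close>

text \<open>
  Specialising every \<open>x\<^sub>i\<close> to \<open>t\<close> in the Fox Jacobian of an automorphism gives a \<open>3 \<times> 3\<close> matrix;
  it fixes \<open>(1, 1, 1)\<^sup>T\<close>, and its action on the quotient is the representation.
\<close>

fun wt :: "complex \<Rightarrow> 'a word \<Rightarrow> complex" where
  "wt t [] = 1"
| "wt t (a # w) = (if snd a then t else inverse t) * wt t w"

fun fox :: "complex \<Rightarrow> 'a word \<Rightarrow> complex ^ 'a" where
  "fox t [] = 0"
| "fox t (a # w) = (if snd a then axis (fst a) 1 + t *s fox t w
     else inverse t *s (fox t w - axis (fst a) 1))"

definition fox_jacobian :: "complex \<Rightarrow> ('a word \<Rightarrow> 'a word) \<Rightarrow> complex ^ 'a ^ 'a" where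
  "fox_jacobian t \<phi> = (\<chi> i. fox t (\<phi> (gen i)))"

definition quotient_mat :: "complex ^ 3 ^ 3 \<Rightarrow> complex ^ 2 ^ 2" where
  "quotient_mat A = mat2 (A $ 1 $ 1 - A $ 3 $ 1) (A $ 1 $ 2 - A $ 3 $ 2)
                         (A $ 2 $ 1 - A $ 3 $ 1) (A $ 2 $ 2 - A $ 3 $ 2)"

context
  fixes t :: complex
  assumes t: "t \<noteq> 0"
begin

lemma wt_nonzero: "wt t w \<noteq> 0"
  by (induction w) (auto simp: t)

lemma wt_push: "wt t (push a w) = wt t (a # w)"
  by (cases w) (auto simp: t)

lemma fox_push: "fox t (push a w) = fox t (a # w)"
  by (cases w) (auto simp: t vec_eq_iff field_simps)

lemma wt_mult: "wt t (u \<otimes>\<^bsub>free_group\<^esub> v) = wt t u * wt t v"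
proof -
  have "wt t (foldr push u v) = wt t u * wt t v"
    by (induction u) (auto simp: wt_push)
  then show ?thesis by (simp add: free_group_def)
qed

lemma fox_mult: "fox t (u \<otimes>\<^bsub>free_group\<^esub> v) = fox t u + wt t u *s fox t v"
proof -
  have "fox t (foldr push u v) = fox t u + wt t u *s fox t v"
    by (induction u) (auto simp: fox_push vec_eq_iff algebra_simps)
  then show ?thesis by (simp add: free_group_def)
qed

lemma wt_one: "wt t \<one>\<^bsub>free_group\<^esub> = 1" and fox_one: "fox t \<one>\<^bsub>free_group\<^esub> = 0"
  by (simp_all add: free_group_def)

lemma wt_gen: "wt t (gen i) = t" and fox_gen: "fox t (gen i) = axis i 1"
  by (simp_all add: gen_def)

lemma wt_inv:
  assumes "u \<in> carrier free_group"
  shows "wt t (inv\<^bsub>free_group\<^esub> u) = inverse (wt t u)"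
proof -
  have "wt t (inv\<^bsub>free_group\<^esub> u) * wt t u = 1"
    using assms by (simp add: wt_mult [symmetric] wt_one)
  then show ?thesis
    using wt_nonzero[of u] by (simp add: field_simps)
qed

lemma fox_inv:
  assumes "u \<in> carrier free_group"
  shows "fox t (inv\<^bsub>free_group\<^esub> u) = - (inverse (wt t u) *s fox t u)"
proof -
  have "fox t (inv\<^bsub>free_group\<^esub> u) + inverse (wt t u) *s fox t u = 0"
    using assms fox_mult[of "inv\<^bsub>free_group\<^esub> u" u] by (simp add: wt_inv fox_one)
  then show ?thesis
    by (simp add: eq_neg_iff_add_eq_0)
qed

lemma sum_fox:
  fixes w :: "('a :: finite) word"
  shows "(t - 1) * (\<Sum>i\<in>UNIV. fox t w $ i) = wt t w - 1"
proof (induction w)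
  case (Cons a w)
  have ax: "(\<Sum>i\<in>UNIV. axis (fst a) (1 :: complex) $ i) = 1"
    by (simp add: axis_def)
  let ?s = "\<Sum>i\<in>UNIV. fox t w $ i"
  have "(\<Sum>i\<in>UNIV. fox t (a # w) $ i) = (if snd a then 1 + t * ?s else inverse t * (?s - 1))"
    by (simp add: sum.distrib sum_subtractf sum_distrib_left [symmetric] ax right_diff_distrib)
  also have "(t - 1) * \<dots> =
      (if snd a then t - 1 + t * ((t - 1) * ?s) else inverse t * ((t - 1) * ?s - (t - 1)))"
    by (simp add: algebra_simps)
  also have "\<dots> = wt t (a # w) - 1"
    using t by (simp add: Cons.IH field_simps)
  finally show ?case .
qed simp

lemma C3_gen:
  assumes "\<phi> \<in> carrier C3"
  obtains p f where "f \<in> carrier F3"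
    "\<phi> (gen i) = inv\<^bsub>F3\<^esub> f \<otimes>\<^bsub>F3\<^esub> gen (p i) \<otimes>\<^bsub>F3\<^esub> f"
  using assms by (auto simp: C3_def)

lemma wt_C3_gen: "\<phi> \<in> carrier C3 \<Longrightarrow> wt t (\<phi> (gen i)) = t"
  by (erule C3_gen[of _ i]) (simp add: wt_mult wt_inv wt_gen wt_nonzero)

lemma jacobian_row_sum:
  assumes "\<phi> \<in> carrier C3"
  shows "(\<Sum>j\<in>UNIV. fox_jacobian t \<phi> $ i $ j) = 1"
proof -
  obtain p f where f: "f \<in> carrier F3"
    and eq: "\<phi> (gen i) = inv\<^bsub>F3\<^esub> f \<otimes>\<^bsub>F3\<^esub> gen (p i) \<otimes>\<^bsub>F3\<^esub> f"
    using assms by (rule C3_gen)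
  let ?s = "\<lambda>w :: 3 word. \<Sum>j\<in>UNIV. fox t w $ j"
  have s: "?s (u \<otimes>\<^bsub>F3\<^esub> v) = ?s u + wt t u * ?s v" for u v
    by (simp add: fox_mult sum.distrib sum_distrib_left)
  have "?s (inv\<^bsub>F3\<^esub> f) = - inverse (wt t f) * ?s f"
    by (simp add: fox_inv f sum_negf sum_distrib_left)
  moreover have "?s (gen (p i)) = 1"
    by (simp add: fox_gen axis_def)
  ultimately have "?s (\<phi> (gen i)) = inverse (wt t f) * (1 + (t - 1) * ?s f)"
    unfolding eq s by (simp add: wt_mult wt_inv wt_gen f algebra_simps)
  then show ?thesis
    using wt_nonzero[of f] by (simp add: sum_fox fox_jacobian_def)
qed

lemma fox_C3:
  assumes "\<phi> \<in> carrier C3" "w \<in> carrier F3"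
  shows "fox t (\<phi> w) = fox t w v* fox_jacobian t \<phi> \<and> wt t (\<phi> w) = wt t w"
proof -
  interpret h: group_hom F3 F3 \<phi>
    using assms(1) by (rule C3_hom)
  have lin: "(u + c *s v) v* A = u v* A + c *s (v v* A)"
    for u v :: "complex ^ 3" and c and A :: "complex ^ 3 ^ 3"
    by (simp add: vec_eq_iff vector_matrix_mult_def sum.distrib sum_distrib_left algebra_simps)
  have gen: "fox t (\<phi> (gen i)) = axis i 1 v* fox_jacobian t \<phi>" for i
    by (simp add: vec_eq_iff vector_matrix_mult_def fox_jacobian_def axis_def if_distrib
        if_distribR cong: if_cong)
  have lin': "(c *s u - c *s v) v* A = c *s (u v* A) - c *s (v v* A)"
    for u v :: "complex ^ 3" and c and A :: "complex ^ 3 ^ 3"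
    by (simp add: vec_eq_iff vector_matrix_mult_def sum_subtractf sum_distrib_left algebra_simps)
  show ?thesis
    using assms(2)
  proof (induction rule: free_group_induct)
    case one
    show ?case by (simp add: fox_one wt_one)
  next
    case (gen i w)
    then show ?case
      by (simp add: fox_mult wt_mult wt_C3_gen[OF assms(1)] wt_gen fox_gen lin
          \<open>fox t (\<phi> (gen i)) = axis i 1 v* fox_jacobian t \<phi>\<close>)
  next
    case (inv i w)
    then show ?case
      by (simp add: fox_mult wt_mult fox_inv wt_inv wt_C3_gen[OF assms(1)] wt_gen fox_gen lin
          lin' gen)
  qed
qed

lemma jacobian_mult:
  assumes "\<phi> \<in> carrier C3" "\<psi> \<in> carrier C3"
  shows "fox_jacobian t (\<phi> \<otimes>\<^bsub>C3\<^esub> \<psi>) = fox_jacobian t \<phi> ** fox_jacobian t \<psi>"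
proof -
  have "\<phi> (gen i) \<in> carrier F3" for i
    using C3_hom[OF assms(1)] by (simp add: group_hom.hom_closed)
  then have "fox t ((\<phi> \<otimes>\<^bsub>C3\<^esub> \<psi>) (gen i)) = fox t (\<phi> (gen i)) v* fox_jacobian t \<psi>" for i
    using fox_C3[OF assms(2)] by (simp add: C3_mult_apply assms)
  then show ?thesis
    by (simp add: fox_jacobian_def[of t "\<phi> \<otimes>\<^bsub>C3\<^esub> \<psi>"] fox_jacobian_def[of t \<phi>]
        vec_eq_iff vector_matrix_mult_def matrix_matrix_mult_def mult.commute)
qed

lemma jacobian_one: "fox_jacobian t \<one>\<^bsub>C3\<^esub> = mat 1"
  by (auto simp: fox_jacobian_def C3_one_apply fox_gen vec_eq_iff mat_def axis_def)

lemma quotient_mat_mult: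
  assumes "\<phi> \<in> carrier C3" "\<psi> \<in> carrier C3"
  shows "quotient_mat (fox_jacobian t (\<phi> \<otimes>\<^bsub>C3\<^esub> \<psi>)) =
         quotient_mat (fox_jacobian t \<phi>) ** quotient_mat (fox_jacobian t \<psi>)"
proof -
  have "fox_jacobian t \<phi> $ i $ 3 = 1 - fox_jacobian t \<phi> $ i $ 1 - fox_jacobian t \<phi> $ i $ 2" for i
    using jacobian_row_sum[OF assms(1), of i] by (simp add: sum_3 algebra_simps)
  note col3 = this[of 1] this[of 2] this[of 3]
  show ?thesis
    by (simp add: jacobian_mult assms quotient_mat_def vec_eq_iff forall_2
        matrix_matrix_mult_def sum_2 sum_3 col3) (simp add: algebra_simps)
qed

lemma quotient_mat_one: "quotient_mat (fox_jacobian t \<one>\<^bsub>C3\<^esub>) = mat 1"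
  by (simp add: jacobian_one quotient_mat_def mat_def vec_eq_iff forall_2)

lemma is_phi_B_jacobian: "is_phi_B t (\<lambda>\<phi>. quotient_mat (fox_jacobian t \<phi>))"
proof -
  interpret C: group C3 by (rule group_C3)
  have "(\<lambda>\<phi>. quotient_mat (fox_jacobian t \<phi>)) \<in> hom C3 GL"
  proof (rule homI)
    fix \<phi> assume \<phi>: "\<phi> \<in> carrier C3"
    then have "quotient_mat (fox_jacobian t \<phi>) ** quotient_mat (fox_jacobian t (inv\<^bsub>C3\<^esub> \<phi>)) = mat 1"
      by (simp add: quotient_mat_mult [symmetric] quotient_mat_one)
    then show "quotient_mat (fox_jacobian t \<phi>) \<in> carrier GL"
      by (auto simp: GL_def invertible_right_inverse)
  qed (simp add: GL_def quotient_mat_mult)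
  moreover have "fox t (inv\<^bsub>F3\<^esub> gen j \<otimes>\<^bsub>F3\<^esub> gen i \<otimes>\<^bsub>F3\<^esub> gen j) =
      inverse t *s axis i 1 + (1 - inverse t) *s axis j 1" for i j :: 3
    using t by (simp add: fox_mult fox_inv fox_gen wt_mult wt_inv wt_gen vec_eq_iff algebra_simps)
  ultimately show ?thesis
    by (simp add: is_phi_B_def quotient_mat_def fox_jacobian_def eps_gen alpha_gen fox_gen axis_def)
qed

end

lemma is_phi_B_phi_B: "t \<noteq> 0 \<Longrightarrow> is_phi_B t (phi_B t)"
  unfolding phi_B_def by (rule someI[of "is_phi_B t", OF is_phi_B_jacobian])

end

theory Submission
  imports Defs
begin

text \<open>
  Write \<open>a = t\<inverse>\<close>, \<open>b = m\<inverse>\<close> and \<open>e\<^sub>i\<^sub>j = e\<^sub>i \<otimes> e\<^sub>j\<close>.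

  If \<open>t = m\<close>, the flip \<open>v \<otimes> w \<mapsto> w \<otimes> v\<close> commutes with the action, so the symmetric tensors form a
  proper non-zero invariant subspace (\<open>tensor_square_reducible\<close>).

  Let \<open>t \<noteq> m\<close>, and let \<open>W\<close> be a non-zero invariant subspace. The generator \<open>\<epsilon>\<^sub>1\<^sub>3\<close> acts as
  \<open>diag(ab, a, b, 1)\<close> in the basis \<open>e\<^sub>1\<^sub>1, e\<^sub>1\<^sub>2, e\<^sub>2\<^sub>1, e\<^sub>2\<^sub>2\<close>. When \<open>a\<close> and \<open>b\<close> both differ from \<open>1\<close>,
  the eigenvalue \<open>a\<close> is simple, so \<open>W\<close> contains \<open>e\<^sub>1\<^sub>2\<close> as soon as one of its
  vectors has a non-zero \<open>e\<^sub>1\<^sub>2\<close>-coordinate; the \<open>\<alpha>\<^sub>i\<close> provide such a vector, and then carry \<open>e\<^sub>1\<^sub>2\<close>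
  to a basis (\<open>UNIV_if_simple_eigenvalue\<close>). When \<open>b = 1\<close>, the \<open>\<epsilon>\<^sub>i\<^sub>j\<close> act on the first factor only,
  and act irreducibly there, so that \<open>W = \<complex>\<^sup>2 \<otimes> U\<close> where \<open>U\<close> is stable under the action of \<open>S\<^sub>3\<close> on
  the second factor, which is the irreducible two-dimensional representation of \<open>S\<^sub>3\<close>
  (\<open>UNIV_if_eps_trivial_on_second_factor\<close>).
  The case \<open>a = 1\<close> is the same up to the flip.
\<close>

section \<open>The flip of a tensor product\<close>

definition flip :: "complex ^ ('m :: finite \<times> 'n :: finite) \<Rightarrow> complex ^ ('n \<times> 'm)" where
  "flip v = (\<chi> p. v $ prod.swap p)"

lemma flip_flip [simp]: "flip (flip v) = v"
  by (simp add: flip_def vec_eq_iff)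

lemma flip_0 [simp]: "flip 0 = 0"
  and flip_add: "flip (v + w) = flip v + flip w"
  and flip_scale: "flip (c *s v) = c *s flip v"
  by (simp_all add: flip_def vec_eq_iff)

lemma flip_kron: "flip (kron A B *v v) = kron B A *v flip v"
proof -
  have "(\<Sum>q\<in>UNIV. A $ j $ fst q * B $ i $ snd q * v $ q) =
        (\<Sum>q\<in>UNIV. B $ i $ fst q * A $ j $ snd q * v $ prod.swap q)" for i j
    by (rule sum.reindex_bij_witness[of _ prod.swap prod.swap]) auto
  then show ?thesis
    by (simp add: flip_def kron_def matrix_vector_mult_def vec_eq_iff)
qed

lemma tensor_square_reducible:
  fixes \<rho> :: "'g \<Rightarrow> complex ^ 'n ^ 'n" and i j :: 'n
  assumes "i \<noteq> j"
  shows "\<not> irreducible_rep G (tensor_rep \<rho> \<rho>)"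
proof
  assume irr: "irreducible_rep G (tensor_rep \<rho> \<rho>)"
  let ?W = "{v :: complex ^ ('n \<times> 'n). flip v = v}"
  have "vec.subspace ?W"
    by (simp add: vec.subspace_def flip_add flip_scale)
  moreover have "tensor_rep \<rho> \<rho> g *v v \<in> ?W" if "v \<in> ?W" for g v
    using that by (simp add: tensor_rep_def flip_kron)
  ultimately have "?W = {0} \<or> ?W = UNIV"
    using irr unfolding irreducible_rep_def by blast
  moreover have "axis (i, i) 1 \<in> ?W" "axis (i, i) 1 \<noteq> (0 :: complex ^ ('n \<times> 'n))"
    by (auto simp: flip_def vec_eq_iff axis_def)
  moreover have "axis (i, j) 1 \<notin> ?W"
    using assms by (auto simp: flip_def vec_eq_iff axis_def)
  ultimately show False
    by blast
qed

lemma irreducible_tensor_rep_commute: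
  assumes irr: "irreducible_rep G (tensor_rep \<rho> \<sigma>)"
  shows "irreducible_rep G (tensor_rep \<sigma> \<rho>)"
  unfolding irreducible_rep_def
proof (intro allI impI, elim conjE)
  fix W
  assume sub: "vec.subspace W" and inv: "\<forall>g\<in>carrier G. \<forall>v\<in>W. tensor_rep \<sigma> \<rho> g *v v \<in> W"
  let ?W = "{v. flip v \<in> W}"
  have "vec.subspace ?W"
    using sub by (simp add: vec.subspace_def flip_add flip_scale)
  moreover have "\<forall>g\<in>carrier G. \<forall>v\<in>?W. tensor_rep \<rho> \<sigma> g *v v \<in> ?W"
    using inv by (simp add: tensor_rep_def flip_kron)
  ultimately have W: "?W = {0} \<or> ?W = UNIV"
    using irr unfolding irreducible_rep_def by blast
  have "W = flip ` ?W"
    by (force intro: image_eqI[where x = "flip _"])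
  also from W have "flip ` ?W = {0} \<or> flip ` ?W = range flip"
  proof
    assume "?W = {0}"
    then show ?thesis by (simp only: image_insert image_empty flip_0) simp
  next
    assume "?W = UNIV"
    then show ?thesis by (simp only:) simp
  qed
  also have "range flip = UNIV"
    by (rule surjI[of flip flip]) simp
  finally show "W = {0} \<or> W = UNIV" .
qed

section \<open>Coordinates on the tensor square of the plane\<close>

definition quad :: "complex \<Rightarrow> complex \<Rightarrow> complex \<Rightarrow> complex \<Rightarrow> complex ^ (2 \<times> 2)" where
  "quad x y z w = (\<chi> p. if p = (1, 1) then x else if p = (1, 2) then y
                        else if p = (2, 1) then z else w)"

lemma quad_cases:
  obtains x y z w where "v = quad x y z w"
proof
  show "v = quad (v $ (1, 1)) (v $ (1, 2)) (v $ (2, 1)) (v $ (2, 2))"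
    by (simp add: quad_def vec_eq_iff forall_2)
qed

lemma quad_0: "quad 0 0 0 0 = 0"
  and quad_add: "quad x y z w + quad x' y' z' w' = quad (x + x') (y + y') (z + z') (w + w')"
  and quad_scale: "c *s quad x y z w = quad (c * x) (c * y) (c * z) (c * w)"
  by (simp_all add: quad_def vec_eq_iff)

lemma kron_mat2_quad:
  "kron (mat2 a b c d) (mat2 a' b' c' d') *v quad x y z w =
   quad (a * a' * x + a * b' * y + b * a' * z + b * b' * w)
        (a * c' * x + a * d' * y + b * c' * z + b * d' * w)
        (c * a' * x + c * b' * y + d * a' * z + d * b' * w)
        (c * c' * x + c * d' * y + d * c' * z + d * d' * w)"
proof -
  have "sum f UNIV = f (1, 1) + f (1, 2) + f (2, 1) + f (2, 2)"
    for f :: "2 \<times> 2 \<Rightarrow> complex"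
    by (simp add: UNIV_Times_UNIV [symmetric] UNIV_2 insert_Times_insert add.assoc
        del: UNIV_Times_UNIV)
  then show ?thesis
    by (simp add: kron_def matrix_vector_mult_def vec_eq_iff forall_2 quad_def)
qed

section \<open>Invariant subspaces\<close>

text \<open>
  The actions of \<open>\<epsilon>\<^sub>1\<^sub>3\<close>, \<open>\<alpha>\<^sub>1\<close>, \<open>\<alpha>\<^sub>2\<close> and \<open>\<epsilon>\<^sub>1\<^sub>2\<close> in coordinates, with \<open>a = t\<inverse>\<close> and \<open>b = m\<inverse>\<close>. For
  \<open>a \<noteq> 1\<close> and \<open>a \<noteq> b\<close> these four matrices already have no common proper non-zero invariant subspace.
\<close>

locale stable_subspace =
  fixes a b :: complex and W :: "(complex ^ (2 \<times> 2)) set"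
  assumes subspace: "vec.subspace W"
    and eps13: "quad x y z w \<in> W \<Longrightarrow> quad (a * b * x) (a * y) (b * z) w \<in> W"
    and alpha1: "quad x y z w \<in> W \<Longrightarrow> quad w z y x \<in> W"
    and alpha2: "quad x y z w \<in> W \<Longrightarrow> quad (x - y - z + w) (w - y) (w - z) w \<in> W"
    and eps12: "quad x y z w \<in> W \<Longrightarrow>
      quad (a * b * x + a * (1 - b) * y + (1 - a) * b * z + (1 - a) * (1 - b) * w)
           (a * y + (1 - a) * w) (b * z + (1 - b) * w) w \<in> W"
begin

lemma add: "quad x y z w \<in> W \<Longrightarrow> quad x' y' z' w' \<in> W \<Longrightarrow>
    quad (x + x') (y + y') (z + z') (w + w') \<in> W"
  using vec.subspace_add[OF subspace] by (metis quad_add)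

lemma scale: "quad x y z w \<in> W \<Longrightarrow> quad (c * x) (c * y) (c * z) (c * w) \<in> W"
  using vec.subspace_scale[OF subspace] by (metis quad_scale)

lemma unscale: "quad (c * x) (c * y) (c * z) (c * w) \<in> W \<Longrightarrow> c \<noteq> 0 \<Longrightarrow> quad x y z w \<in> W"
  using scale[of "c * x" "c * y" "c * z" "c * w" "inverse c"] by (simp add: mult.assoc [symmetric])

text \<open>When \<open>c\<close> is an eigenvalue of \<open>\<epsilon>\<^sub>1\<^sub>3\<close>, this kills its eigenspace; such steps compose to projections.\<close>

lemma eps13_minus_scalar:
  assumes "quad x y z w \<in> W"
  shows "quad ((a * b - c) * x) ((a - c) * y) ((b - c) * z) ((1 - c) * w) \<in> W"
  using add[OF eps13[OF assms] scale[OF assms, of "- c"]] by (simp add: algebra_simps)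

lemma UNIV_if_basis:
  assumes e11: "quad 1 0 0 0 \<in> W" and e12: "quad 0 1 0 0 \<in> W"
  shows "W = UNIV"
proof -
  have "v \<in> W" for v
  proof -
    obtain x y z w where v: "v = quad x y z w"
      by (rule quad_cases)
    have "quad x y 0 0 \<in> W" for x y
      using add[OF scale[OF e11, of x] scale[OF e12, of y]] by simp
    from add[OF this[of x y] alpha1[OF this[of w z]]] show ?thesis
      by (simp add: v)
  qed
  then show ?thesis
    by blast
qed

text \<open>
  The eigenvalue \<open>a\<close> of \<open>\<epsilon>\<^sub>1\<^sub>3\<close> differs from the other eigenvalues \<open>ab\<close>, \<open>b\<close> and \<open>1\<close>. A non-zero vector without
  \<open>e\<^sub>1\<^sub>2\<close>-coordinate acquires one under \<open>\<alpha>\<^sub>1\<close> or \<open>\<alpha>\<^sub>2\<close> or both.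
\<close>

lemma UNIV_if_simple_eigenvalue:
  assumes nz: "W \<noteq> {0}" and a: "a \<noteq> 0" "a \<noteq> 1" "b \<noteq> 1" "a \<noteq> b"
  shows "W = UNIV"
proof -
  have project: "quad 0 1 0 0 \<in> W" if "quad x y z w \<in> W" "y \<noteq> 0" for x y z w
  proof (rule unscale)
    let ?c = "(a - 1) * ((a - b) * ((a - a * b) * y))"
    show "quad (?c * 0) (?c * 1) (?c * 0) (?c * 0) \<in> W"
      using eps13_minus_scalar[OF eps13_minus_scalar[OF
          eps13_minus_scalar[OF that(1), of "a * b"], of b], of 1] by simp
    show "?c \<noteq> 0"
      using a \<open>y \<noteq> 0\<close> by simp
  qed
  obtain v where "v \<in> W" "v \<noteq> 0"
    using nz vec.subspace_0[OF subspace] by blast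
  moreover obtain x y z w where "v = quad x y z w"
    by (rule quad_cases)
  ultimately have v: "quad x y z w \<in> W" and "x \<noteq> 0 \<or> y \<noteq> 0 \<or> z \<noteq> 0 \<or> w \<noteq> 0"
    using quad_0 by auto
  then consider "y \<noteq> 0" | "z \<noteq> 0" | "y = 0" "w \<noteq> 0" | "z = 0" "x \<noteq> 0"
    by blast
  then have e12: "quad 0 1 0 0 \<in> W"
  proof cases
    case 1
    with v show ?thesis by (rule project)
  next
    case 2
    with alpha1[OF v] show ?thesis by (rule project)
  next
    case 3
    then show ?thesis by (intro project[OF alpha2[OF v]]) simp
  next
    case 4
    then show ?thesis by (intro project[OF alpha2[OF alpha1[OF v]]]) simp
  qed
  have "quad (-1) 0 0 0 \<in> W"
    using add[OF e12 alpha2[OF e12]] by simp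
  from scale[OF this, of "-1"] have "quad 1 0 0 0 \<in> W"
    by simp
  then show ?thesis
    using e12 by (rule UNIV_if_basis)
qed

text \<open>
  For \<open>b = 1\<close> the \<open>\<epsilon>\<^sub>i\<^sub>j\<close> act trivially on the second factor, and \<open>quad x y 0 0\<close> is
  \<open>e\<^sub>1 \<otimes> (x, y)\<close>. So \<open>U = {u. e\<^sub>1 \<otimes> u \<in> W}\<close> is stable under the matrices of \<open>\<alpha>\<^sub>1\<close> and \<open>\<alpha>\<^sub>2\<close>. The
  latter is a reflection with axis \<open>e\<^sub>1\<close>, hence \<open>u + \<alpha>\<^sub>2 u\<close> is a multiple of \<open>e\<^sub>1\<close>.
\<close>

lemma UNIV_if_eps_trivial_on_second_factor:
  assumes nz: "W \<noteq> {0}" and a: "a \<noteq> 1" and b: "b = 1"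
  shows "W = UNIV"
proof -
  have first_row: "quad x y 0 0 \<in> W" if "quad x y z w \<in> W" for x y z w
    using eps13_minus_scalar[OF that, of 1] a b by (simp add: unscale[of "a - 1"])
  have swap: "quad y x 0 0 \<in> W" if "quad x y 0 0 \<in> W" for x y
  proof (rule unscale)
    \<comment> \<open>\<open>\<alpha>\<^sub>1\<close> gives \<open>e\<^sub>2 \<otimes> (y, x)\<close>, and \<open>\<epsilon>\<^sub>1\<^sub>2\<close> sends \<open>e\<^sub>2\<close> to \<open>(1 - a) e\<^sub>1 + e\<^sub>2\<close>.\<close>
    show "quad ((1 - a) * y) ((1 - a) * x) ((1 - a) * 0) ((1 - a) * 0) \<in> W"
      using first_row[OF eps12[OF alpha1[OF that]]] b by simp
    show "1 - a \<noteq> 0"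
      using a by simp
  qed
  have axis: "quad 1 0 0 0 \<in> W" if "quad x y 0 0 \<in> W" "2 * x \<noteq> y" for x y
  proof (rule unscale)
    show "quad ((2 * x - y) * 1) ((2 * x - y) * 0) ((2 * x - y) * 0) ((2 * x - y) * 0) \<in> W"
      using add[OF that(1) alpha2[OF that(1)]] by (simp add: algebra_simps)
    show "2 * x - y \<noteq> 0"
      using that(2) by simp
  qed
  have e11: "quad 1 0 0 0 \<in> W" if "quad x y 0 0 \<in> W" "x \<noteq> 0 \<or> y \<noteq> 0" for x y
  proof (cases "2 * x = y")
    case False
    with that(1) show ?thesis by (rule axis)
  next
    case True
    with that(2) have "2 * y \<noteq> x" by auto
    with swap[OF that(1)] show ?thesis by (rule axis)
  qed
  obtain v where "v \<in> W" "v \<noteq> 0"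
    using nz vec.subspace_0[OF subspace] by blast
  moreover obtain x y z w where "v = quad x y z w"
    by (rule quad_cases)
  ultimately have v: "quad x y z w \<in> W" and "(x \<noteq> 0 \<or> y \<noteq> 0) \<or> (w \<noteq> 0 \<or> z \<noteq> 0)"
    using quad_0 by auto
  then have "quad 1 0 0 0 \<in> W"
    using e11[OF first_row[OF v]] e11[OF first_row[OF alpha1[OF v]]] by blast
  then show ?thesis
    using swap by (intro UNIV_if_basis)
qed

end

section \<open>Irreducibility\<close>

lemma stable_subspace_invariant:
  assumes "is_phi_B t \<rho>" "is_phi_B m \<sigma>" and sub: "vec.subspace W"
    and inv: "\<forall>g\<in>carrier C3. \<forall>v\<in>W. tensor_rep \<rho> \<sigma> g *v v \<in> W"
  shows "stable_subspace (inverse t) (inverse m) W"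
proof -
  have stable: "kron (\<rho> g) (\<sigma> g) *v v \<in> W" if "g \<in> carrier C3" "v \<in> W" for g v
    using inv that by (simp add: tensor_rep_def)
  note phi = assms(1,2)[unfolded is_phi_B_def]
  show ?thesis
  proof (unfold_locales, fact sub)
    fix x y z w :: complex
    assume v: "quad x y z w \<in> W"
    show "quad (inverse t * inverse m * x) (inverse t * y) (inverse m * z) w \<in> W"
      using stable[OF eps_closed[of 1 3] v] phi by (simp add: kron_mat2_quad)
    show "quad w z y x \<in> W"
      using stable[OF alpha_closed[of 1] v] phi by (simp add: kron_mat2_quad)
    show "quad (x - y - z + w) (w - y) (w - z) w \<in> W"
      using stable[OF alpha_closed[of 2] v] phi by (simp add: kron_mat2_quad)
    show "quad (inverse t * inverse m * x + inverse t * (1 - inverse m) * y +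
          (1 - inverse t) * inverse m * z + (1 - inverse t) * (1 - inverse m) * w)
        (inverse t * y + (1 - inverse t) * w) (inverse m * z + (1 - inverse m) * w) w \<in> W"
      using stable[OF eps_closed[of 1 2] v] phi by (simp add: kron_mat2_quad)
  qed
qed

lemma irreducible_tensor_rep_phi_B:
  assumes "is_phi_B t \<rho>" "is_phi_B m \<sigma>" and "t \<noteq> 0" "t \<noteq> 1" "t \<noteq> m"
  shows "irreducible_rep C3 (tensor_rep \<rho> \<sigma>)"
  unfolding irreducible_rep_def
proof (intro allI impI disjCI, elim conjE)
  fix W
  assume "vec.subspace W" "\<forall>g\<in>carrier C3. \<forall>v\<in>W. tensor_rep \<rho> \<sigma> g *v v \<in> W" "W \<noteq> UNIV"
  then interpret stable_subspace "inverse t" "inverse m" W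
    using stable_subspace_invariant assms(1,2) by blast
  show "W = {0}"
  proof (rule ccontr)
    assume "W \<noteq> {0}"
    with assms(3-5) have "W = UNIV"
      using UNIV_if_simple_eigenvalue UNIV_if_eps_trivial_on_second_factor
      by (cases "m = 1") simp_all
    with \<open>W \<noteq> UNIV\<close> show False ..
  qed
qed

theorem theorem9:
  fixes t m :: complex
  assumes "t \<noteq> 0" and "m \<noteq> 0"
  shows "irreducible_rep C3 (tensor_rep (phi_B t) (phi_B m)) \<longleftrightarrow> t \<noteq> m"
proof
  assume "irreducible_rep C3 (tensor_rep (phi_B t) (phi_B m))"
  then show "t \<noteq> m"
    using tensor_square_reducible[of "1 :: 2" 2 C3 "phi_B t"] by auto
next
  assume "t \<noteq> m"
  note phi = is_phi_B_phi_B[OF assms(1)] is_phi_B_phi_B[OF assms(2)]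
  show "irreducible_rep C3 (tensor_rep (phi_B t) (phi_B m))"
  proof (cases "t = 1")
    case False
    with phi assms \<open>t \<noteq> m\<close> show ?thesis
      by (intro irreducible_tensor_rep_phi_B)
  next
    case True
    with assms \<open>t \<noteq> m\<close> show ?thesis
      by (intro irreducible_tensor_rep_commute[OF irreducible_tensor_rep_phi_B[OF phi(2,1)]]) auto
  qed
qed

end
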